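(* Let $\mathfrak{X}=\{X_1,\dots,X_n\}$ be a frame of linearly independent smooth vector fields on $\mathbb{R}^n$, with induced Riemannian metric $g$ and distance $d$, and let $\mathfrak{Z}=\mathfrak{X}\otimes\mathfrak{X}$ be the doubled frame on $\mathbb{R}^n\times\mathbb{R}^n$. Let $\alpha\in\mathbb{R}$. In any open region of $\{(x,y)\in\mathbb{R}^n\times\mathbb{R}^n: x\ne y\}$ in which $(x,y)\mapsto d(x,y)$ is smooth, one has, with $d=d(x,y)$, $$\langle D^2_{\mathfrak{Z}}d^{\alpha}\cdot D_{\mathfrak{Z}}d^{\alpha},D_{\mathfrak{Z}}d^{\alpha}\rangle_g=4\alpha^3(\alpha-1)\,d^{3\alpha-4},$$ $$\langle (D^2_{\mathfrak{Z}}d^{\alpha})^*\cdot D_{\mathfrak{Z}}d^{\alpha},D_{\mathfrak{Z}}d^{\alpha}\rangle_g=4\alpha^3(\alpha-1)\,d^{3\alpha-4}.$$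
   Context: The Riemannian metric $g$ on $\mathbb{R}^n$ is the one for which $\{X_1(x),\dots,X_n(x)\}$ is orthonormal at every $x$; $d$ is its Riemannian distance. $X_i^x$ and $X_i^y$ denote the vector field $X_i$ acting on the $x$ variable and on the $y$ variable, respectively. For a smooth function $u(x,y)$, the $\mathfrak{Z}$-gradient $D_{\mathfrak{Z}}u$ is the $2n\times1$ column vector $(X_1^xu,\dots,X_n^xu,X_1^yu,\dots,X_n^yu)^t$. $D^2_{\mathfrak{Z}}u$ is the $2n\times 2n$ matrix with $n\times n$ blocks $$D^2_{\mathfrak{Z}}u=\begin{pmatrix}(X_i^xX_j^xu)_{ij}&(X_i^xX_j^yu)_{ij}\\ (X_i^yX_j^xu)_{ij}&(X_i^yX_j^yu)_{ij}\end{pmatrix},$$ and $(D^2_{\mathfrak{Z}}u)^*=\frac12\big(D^2_{\mathfrak{Z}}u+(D^2_{\mathfrak{Z}}u)^t\big)$. On such $2n$-vectors of frame components, $\langle v,w\rangle_g=\sum_{k=1}^{2n}v_kw_k$. *)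

theory Defs
  imports "HOL-Analysis.Analysis"
begin

text \<open>
  Meant for open \<open>S\<close>. On a finite-dimensional domain, \<open>f\<close> is \<open>C^(k+1)\<close> iff it is
  differentiable and each of its directional derivatives is \<open>C^k\<close>.
\<close>

primrec Ck_on ::
  "nat \<Rightarrow> 'a::euclidean_space set \<Rightarrow> ('a \<Rightarrow> 'b::real_normed_vector) \<Rightarrow> bool" where
  "Ck_on 0 S f \<longleftrightarrow> continuous_on S f"
| "Ck_on (Suc k) S f \<longleftrightarrow>
     (\<forall>x\<in>S. f differentiable (at x)) \<and>
     (\<forall>v. Ck_on k S (\<lambda>x. frechet_derivative f (at x) v))"

definition smooth_on ::
  "'a::euclidean_space set \<Rightarrow> ('a \<Rightarrow> 'b::real_normed_vector) \<Rightarrow> bool" where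
  "smooth_on S f \<longleftrightarrow> (\<forall>k. Ck_on k S f)"

definition smooth_frame :: "('n::finite \<Rightarrow> real^'n \<Rightarrow> real^'n) \<Rightarrow> bool" where
  "smooth_frame X \<longleftrightarrow>
     (\<forall>i. smooth_on UNIV (X i)) \<and>
     (\<forall>x. inj (\<lambda>i. X i x) \<and> independent (range (\<lambda>i. X i x)))"

definition frame_metric ::
  "('n::finite \<Rightarrow> real^'n \<Rightarrow> real^'n) \<Rightarrow> real^'n \<Rightarrow> real^'n \<Rightarrow> real^'n \<Rightarrow> real" where
  "frame_metric X x =
     (THE b. bilinear b \<and> (\<forall>i j. b (X i x) (X j x) = (if i = j then 1 else 0)))"

lemma frame_metric_unique_existence:
  fixes X :: "'n::finite \<Rightarrow> real^'n \<Rightarrow> real^'n"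
  assumes "smooth_frame X"
  shows "\<exists>!b :: real^'n \<Rightarrow> real^'n \<Rightarrow> real.
           bilinear b \<and> (\<forall>i j. b (X i x) (X j x) = (if i = j then 1 else 0))"
proof -
  let ?B = "range (\<lambda>i. X i x)"
  have inj: "inj (\<lambda>i. X i x)" and ind: "independent ?B"
    using assms by (auto simp: smooth_frame_def)
  have "card ?B = dim (UNIV :: (real^'n) set)"
    using inj by (simp add: card_image)
  then have span: "UNIV \<subseteq> span ?B"
    using ind card_ge_dim_independent[of ?B UNIV] by auto
  obtain T :: "real^'n \<Rightarrow> real^'n" where T: "linear T"
    and Tb: "\<forall>v\<in>?B. T v = axis (inv (\<lambda>i. X i x) v) 1"
    using linear_independent_extend[OF ind, of "\<lambda>v. axis (inv (\<lambda>i. X i x) v) 1"] by blast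
  have TX: "T (X i x) = axis i 1" for i
    using Tb inj by (simp add: inv_f_f[OF inj])
  show ?thesis
  proof (rule ex1I)
    show "bilinear (\<lambda>v w. T v \<bullet> T w) \<and>
      (\<forall>i j. T (X i x) \<bullet> T (X j x) = (if i = j then 1 else 0))"
      using T by (auto simp: bilinear_def TX inner_axis_axis linear_iff inner_add_left inner_add_right)
  next
    fix b :: "real^'n \<Rightarrow> real^'n \<Rightarrow> real"
    assume b: "bilinear b \<and> (\<forall>i j. b (X i x) (X j x) = (if i = j then 1 else 0))"
    have T2: "bilinear (\<lambda>v w. T v \<bullet> T w)"
      using T by (auto simp: bilinear_def linear_iff inner_add_left inner_add_right)
    have "b v w = T v \<bullet> T w" for v w
      by (rule bilinear_eq[OF _ T2 span span]) (use b in \<open>auto simp: TX inner_axis_axis\<close>)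
    then show "b = (\<lambda>v w. T v \<bullet> T w)" by blast
  qed
qed

lemma
  assumes "smooth_frame X"
  shows bilinear_frame_metric: "bilinear (frame_metric X x)"
    and frame_metric_orthonormal:
      "frame_metric X x (X i x) (X j x) = (if i = j then 1 else 0)"
  using theI'[OF frame_metric_unique_existence[OF assms, of x]]
  by (simp_all add: frame_metric_def)

definition C1_curve :: "(real \<Rightarrow> 'a::real_normed_vector) \<Rightarrow> real \<Rightarrow> real \<Rightarrow> bool" where
  "C1_curve \<gamma> a b \<longleftrightarrow>
     (\<exists>\<gamma>'. continuous_on {a..b} \<gamma>' \<and>
        (\<forall>t\<in>{a..b}. (\<gamma> has_vector_derivative \<gamma>' t) (at t within {a..b})))"

text \<open>
  The finite set \<open>T\<close> contains the break points. The library predicate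
  \<open>piecewise_C1_differentiable_on\<close> does not require the derivative to have one-sided limits
  at the break points, so it admits curves of infinite length, whose \<open>integral\<close> defaults to 0;
  it is therefore not suitable here.
\<close>

definition piecewise_C1_curve ::
  "(real \<Rightarrow> 'a::real_normed_vector) \<Rightarrow> real \<Rightarrow> real \<Rightarrow> bool" where
  "piecewise_C1_curve \<gamma> a b \<longleftrightarrow>
     continuous_on {a..b} \<gamma> \<and>
     (\<exists>T. finite T \<and>
        (\<forall>s t. a \<le> s \<and> s < t \<and> t \<le> b \<and> {s<..<t} \<inter> T = {} \<longrightarrow> C1_curve \<gamma> s t))"

definition frame_length ::
  "('n::finite \<Rightarrow> real^'n \<Rightarrow> real^'n) \<Rightarrow> (real \<Rightarrow> real^'n) \<Rightarrow> real \<Rightarrow> real \<Rightarrow> real" where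
  "frame_length X \<gamma> a b =
     integral {a..b} (\<lambda>t.
       let v = vector_derivative \<gamma> (at t within {a..b})
       in sqrt (frame_metric X (\<gamma> t) v v))"

definition frame_dist ::
  "('n::finite \<Rightarrow> real^'n \<Rightarrow> real^'n) \<Rightarrow> real^'n \<Rightarrow> real^'n \<Rightarrow> real" where
  "frame_dist X x y =
     Inf {frame_length X \<gamma> a b |\<gamma> a b.
            a < b \<and> piecewise_C1_curve \<gamma> a b \<and> \<gamma> a = x \<and> \<gamma> b = y}"

definition vf_deriv ::
  "('a::real_normed_vector \<Rightarrow> 'a) \<Rightarrow> ('a \<Rightarrow> real) \<Rightarrow> 'a \<Rightarrow> real" where
  "vf_deriv V f x = frechet_derivative f (at x) (V x)"

text \<open>
  The doubled frame, indexed by the disjoint sum: \<open>Inl i\<close> is \<open>X i\<close> acting on the first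
  variable and \<open>Inr i\<close> is \<open>X i\<close> acting on the second. Matrices over this index type are
  the 2n by 2n block matrices.
\<close>

fun doubled_deriv ::
  "('n::finite \<Rightarrow> real^'n \<Rightarrow> real^'n) \<Rightarrow> 'n + 'n \<Rightarrow>
     ((real^'n) \<times> (real^'n) \<Rightarrow> real) \<Rightarrow> (real^'n) \<times> (real^'n) \<Rightarrow> real" where
  "doubled_deriv X (Inl i) u (x, y) = vf_deriv (X i) (\<lambda>x'. u (x', y)) x"
| "doubled_deriv X (Inr i) u (x, y) = vf_deriv (X i) (\<lambda>y'. u (x, y')) y"

definition doubled_grad ::
  "('n::finite \<Rightarrow> real^'n \<Rightarrow> real^'n) \<Rightarrow>
     ((real^'n) \<times> (real^'n) \<Rightarrow> real) \<Rightarrow> (real^'n) \<times> (real^'n) \<Rightarrow> real^('n + 'n)" where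
  "doubled_grad X u p = (\<chi> k. doubled_deriv X k u p)"

definition doubled_hess ::
  "('n::finite \<Rightarrow> real^'n \<Rightarrow> real^'n) \<Rightarrow>
     ((real^'n) \<times> (real^'n) \<Rightarrow> real) \<Rightarrow> (real^'n) \<times> (real^'n) \<Rightarrow>
     real^('n + 'n)^('n + 'n)" where
  "doubled_hess X u p = (\<chi> k l. doubled_deriv X k (doubled_deriv X l u) p)"

definition sym_part :: "real^'m^'m \<Rightarrow> real^'m^'m" where
  "sym_part A = (1/2) *\<^sub>R (A + transpose A)"

end

theory Submission
  imports Defs
begin

text \<open>
  Both partial gradients of \<open>d\<close> have length 1, so \<open>d\<close> satisfies \<open>|D d|\<^sup>2 = 2\<close>
  for the doubled frame. With \<open>u = d\<^sup>\<alpha>\<close> this gives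
  \<open>|D u|\<^sup>2 = 2 \<alpha>\<^sup>2 d powr (2 \<alpha> - 2)\<close>; since the Hessian applied to \<open>D u\<close> is half the
  frame gradient of \<open>|D u|\<^sup>2\<close>, the claim follows by pairing with \<open>D u\<close>.

  The metric need not be complete, so minimizing geodesics may not exist. The upper bound in the
  eikonal equation comes from short segments and the triangle inequality. For the lower bound,
  every curve from \<open>x\<close> to \<open>y\<close> crosses each small sphere around \<open>x\<close>; a nearly minimizing one
  does so at a point \<open>z\<close> whose distance to \<open>y\<close> is smaller than \<open>d(x, y)\<close> by almost the radius.
\<close>

section \<open>Frame coefficients and the metric in frame coordinates\<close>

text \<open>Orthonormality makes the pairing with \<open>X i x\<close> read off the i-th coefficient
  of a vector in the frame at \<open>x\<close>. This is therefore the inverse of the map that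
  assembles a vector from its coefficients.\<close>

definition coframe :: "('n::finite \<Rightarrow> real^'n \<Rightarrow> real^'n) \<Rightarrow> real^'n \<Rightarrow> real^'n \<Rightarrow> real^'n" where
  "coframe X x v = (\<chi> i. frame_metric X x (X i x) v)"

lemma span_frame:
  fixes X :: "'n::finite \<Rightarrow> real^'n \<Rightarrow> real^'n"
  assumes "smooth_frame X"
  shows "span (range (\<lambda>i. X i x)) = UNIV"
proof -
  let ?B = "range (\<lambda>i. X i x)"
  have inj: "inj (\<lambda>i. X i x)" and ind: "independent ?B"
    using assms by (auto simp: smooth_frame_def)
  have "card ?B = dim (UNIV :: (real^'n) set)"
    using inj by (simp add: card_image)
  then show ?thesis
    using ind card_ge_dim_independent[of ?B UNIV] by auto
qed

lemma linear_coframe: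
  assumes "smooth_frame X"
  shows "linear (coframe X x)"
  using bilinear_frame_metric[OF assms, of x]
  by (auto simp: bilinear_def coframe_def linear_iff vec_eq_iff)

lemma coframe_frame:
  assumes "smooth_frame X"
  shows "coframe X x (X i x) = axis i 1"
  by (auto simp: coframe_def frame_metric_orthonormal[OF assms] vec_eq_iff axis_def)

lemma frame_expansion:
  fixes X :: "'n::finite \<Rightarrow> real^'n \<Rightarrow> real^'n"
  assumes X: "smooth_frame X"
  shows "(\<Sum>i\<in>UNIV. (coframe X x v $ i) *\<^sub>R X i x) = v"
proof (rule linear_eq_on_span[where f = "\<lambda>v. \<Sum>i\<in>UNIV. (coframe X x v $ i) *\<^sub>R X i x" and g = "\<lambda>v. v"])
  show "linear (\<lambda>v. \<Sum>i\<in>UNIV. (coframe X x v $ i) *\<^sub>R X i x)"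
    using linear_coframe[OF X, of x]
    by (auto simp: linear_iff algebra_simps sum.distrib scaleR_sum_right)
  show "v \<in> span (range (\<lambda>i. X i x))"
    using span_frame[OF X] by simp
  show "(\<Sum>i\<in>UNIV. (coframe X x w $ i) *\<^sub>R X i x) = w" if w: "w \<in> range (\<lambda>i. X i x)" for w
  proof -
    from w obtain j where j: "w = X j x" by auto
    show ?thesis
      unfolding j coframe_frame[OF X] axis_def
      by (simp add: if_distrib[of "\<lambda>c. c *\<^sub>R _"] cong: if_cong)
  qed
qed (simp add: linear_iff)

text \<open>Two bilinear forms that agree on a spanning set are equal. From here on lengths are
  Euclidean norms of coefficient vectors, so estimates need only linearity of
  \<open>coframe X x\<close>.\<close>

lemma frame_metric_eq_coframe:
  assumes X: "smooth_frame X"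
  shows "frame_metric X x v w = coframe X x v \<bullet> coframe X x w"
proof (rule bilinear_eq[OF bilinear_frame_metric[OF X]])
  show "bilinear (\<lambda>v w. coframe X x v \<bullet> coframe X x w)"
    using linear_coframe[OF X, of x]
    by (auto simp: bilinear_def linear_iff inner_add_left inner_add_right)
  show "UNIV \<subseteq> span (range (\<lambda>i. X i x))" "UNIV \<subseteq> span (range (\<lambda>i. X i x))"
    using span_frame[OF X, of x] by simp_all
qed (auto simp: coframe_frame[OF X] inner_axis_axis frame_metric_orthonormal[OF X])

lemma coframe_combination:
  assumes X: "smooth_frame X"
  shows "coframe X x (\<Sum>i\<in>UNIV. (c $ i) *\<^sub>R X i x) = c"
  using linear_coframe[OF X, of x]
  by (simp add: linear_sum linear_cmul coframe_frame[OF X] vec_eq_iff axis_def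
      if_distrib[of "\<lambda>c. _ * c"] cong: if_cong)

lemma coframe_eq_0_iff:
  assumes X: "smooth_frame X"
  shows "coframe X x v = 0 \<longleftrightarrow> v = 0"
  using frame_expansion[OF X, of x v] linear_0[OF linear_coframe[OF X]] by force

lemma smooth_frame_differentiable:
  "smooth_frame X \<Longrightarrow> X i differentiable (at x)"
  unfolding smooth_frame_def smooth_on_def by (metis Ck_on.simps(2) UNIV_I)

lemma smooth_frame_continuous:
  "smooth_frame X \<Longrightarrow> continuous_on S (X i)"
  by (meson smooth_frame_differentiable continuous_at_imp_continuous_on differentiable_imp_continuous_within)

text \<open>The metric is given by a definite description at each point separately, so its
  dependence on the base point has to be established. Joint continuity is used for integrability of
  speeds and for comparing nearby metrics.\<close>

lemma continuous_on_coframe: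
  fixes X :: "'n::finite \<Rightarrow> real^'n \<Rightarrow> real^'n" and f g :: "'a::topological_space \<Rightarrow> real^'n"
  assumes X: "smooth_frame X" and f: "continuous_on S f" and g: "continuous_on S g"
  shows "continuous_on S (\<lambda>s. coframe X (f s) (g s))"
proof -
  define M where "M z = (\<chi> i j. X j z $ i)" for z
  have M: "M z *v c = (\<Sum>i\<in>UNIV. (c $ i) *\<^sub>R X i z)" for z c
    by (simp add: M_def matrix_vector_mult_def vec_eq_iff mult.commute)
  have Mc: "M z *v coframe X z v = v" for z v
    by (simp add: M frame_expansion[OF X])
  \<comment> \<open>Cramer's rule expresses the coframe through entries that are visibly continuous.\<close>
  have nz: "det (M z) \<noteq> 0" for z
  proof -
    have "surj ((*v) (M z))" by (metis Mc surjI)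
    then show ?thesis
      by (metis invertible_det_nz invertible_right_inverse matrix_right_invertible_surjective)
  qed
  have cof: "coframe X z v = (\<chi> k. det (\<chi> i j. if j = k then v $ i else M z $ i $ j) / det (M z))" for z v
    using Mc nz cramer by blast
  have cX: "continuous_on S (\<lambda>s. X j (f s))" for j
    using smooth_frame_continuous[OF X] f continuous_on_compose2 by blast
  have cM: "continuous_on S (\<lambda>s. M (f s) $ i $ j)" for i j
    unfolding M_def by (simp, intro continuous_intros cX)
  have cA: "continuous_on S (\<lambda>s. if j = k then g s $ i else M (f s) $ i $ j)" for i j k
    by (cases "j = k") (auto intro!: continuous_intros cM g)
  have "continuous_on S (\<lambda>s. det (\<chi> i j. if j = k then g s $ i else M (f s) $ i $ j))" for k
    unfolding det_def by (simp, intro continuous_intros cA)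
  moreover have "continuous_on S (\<lambda>s. det (M (f s)))"
    unfolding det_def by (intro continuous_intros cM)
  ultimately show ?thesis
    unfolding cof by (intro continuous_intros) (auto simp: nz)
qed

text \<open>The triangle inequality in the frame expansion gives the bound. It converts between the
  metric norm at \<open>x\<close> and the Euclidean norm, in which continuity and derivatives are
  stated.\<close>

lemma norm_le_coframe:
  fixes X :: "'n::finite \<Rightarrow> real^'n \<Rightarrow> real^'n"
  assumes X: "smooth_frame X"
  obtains B where "0 < B" and "\<And>v. norm v \<le> B * norm (coframe X x v)"
proof
  \<comment> \<open>The added 1 makes positivity immediate.\<close>
  define B where "B = (\<Sum>i\<in>UNIV. norm (X i x)) + 1"
  show "B > 0" by (simp add: B_def add_nonneg_pos sum_nonneg)
  fix v
  have "norm v \<le> (\<Sum>i\<in>UNIV. norm ((coframe X x v $ i) *\<^sub>R X i x))"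
    using norm_sum frame_expansion[OF X, of x v] by metis
  also have "\<dots> \<le> (\<Sum>i\<in>UNIV. norm (coframe X x v) * norm (X i x))"
    by (intro sum_mono) (simp add: mult_right_mono component_le_norm_cart)
  also have "\<dots> \<le> B * norm (coframe X x v)"
    by (simp add: B_def sum_distrib_left algebra_simps)
  finally show "norm v \<le> B * norm (coframe X x v)" .
qed

text \<open>Expand \<open>v\<close> in the frame at \<open>z\<close> with coefficients
  \<open>c\<close>. Replacing each \<open>X i z\<close> by \<open>X i x\<close> gives a vector whose
  coefficients at \<open>x\<close> are exactly \<open>c\<close>, and the error is at most
  \<open>norm c * h z\<close>, where \<open>h\<close> is continuous and vanishes at
  \<open>x\<close>. The ball is measured in the norm at \<open>x\<close> to match the spheres used
  later.\<close>

lemma coframe_comparison: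
  fixes X :: "'n::finite \<Rightarrow> real^'n \<Rightarrow> real^'n"
  assumes X: "smooth_frame X" and e: "0 < e"
  obtains \<delta> where "0 < \<delta>"
    and "\<And>z v. norm (coframe X x (z - x)) \<le> \<delta> \<Longrightarrow>
           norm (coframe X x v) \<le> (1 + e) * norm (coframe X z v)"
proof -
  note lin = linear_coframe[OF X, of x]
  obtain B where B: "0 < B" "\<And>v. norm v \<le> B * norm (coframe X x v)"
    using norm_le_coframe[OF X, of x] by blast
  define h where "h z = (\<Sum>i\<in>UNIV. norm (coframe X x (X i z - X i x)))" for z
  have "continuous_on UNIV h"
    unfolding h_def
    by (intro continuous_intros continuous_on_coframe[OF X] smooth_frame_continuous[OF X])
  moreover have "h x = 0" by (simp add: h_def linear_0[OF lin])
  ultimately obtain d where d: "d > 0" "\<And>z. dist z x < d \<Longrightarrow> h z < e"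
    using e unfolding continuous_on_iff by (force simp: dist_real_def)
  show thesis
  proof
    \<comment> \<open>Dividing by \<open>B\<close> turns the Euclidean radius \<open>d\<close> into
      a metric one; the factor 2 makes the resulting bound strict.\<close>
    show "0 < d / (2 * B)" using d B by simp
    fix z v assume z: "norm (coframe X x (z - x)) \<le> d / (2 * B)"
    have "norm (z - x) \<le> B * (d / (2 * B))"
      using B(2)[of "z - x"] z B(1) by (meson mult_left_mono less_imp_le order_trans)
    also have "\<dots> < d" using B d by simp
    finally have hz: "h z < e" using d by (simp add: dist_norm)
    define c where "c = coframe X z v"
    have "coframe X x v = coframe X x (\<Sum>i\<in>UNIV. (c $ i) *\<^sub>R X i z)"
      by (simp add: c_def frame_expansion[OF X])
    also have "(\<Sum>i\<in>UNIV. (c $ i) *\<^sub>R X i z)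
        = (\<Sum>i\<in>UNIV. (c $ i) *\<^sub>R X i x) + (\<Sum>i\<in>UNIV. (c $ i) *\<^sub>R (X i z - X i x))"
      by (simp add: algebra_simps sum_subtractf)
    also have "coframe X x \<dots> = c + (\<Sum>i\<in>UNIV. (c $ i) *\<^sub>R coframe X x (X i z - X i x))"
      using lin by (simp add: linear_add coframe_combination[OF X] linear_sum linear_cmul)
    finally have "norm (coframe X x v) \<le> norm c + norm (\<Sum>i\<in>UNIV. (c $ i) *\<^sub>R coframe X x (X i z - X i x))"
      by (simp add: norm_triangle_ineq)
    also have "norm (\<Sum>i\<in>UNIV. (c $ i) *\<^sub>R coframe X x (X i z - X i x)) \<le> norm c * h z"
      unfolding h_def sum_distrib_left
      by (intro sum_norm_le) (simp add: mult_right_mono component_le_norm_cart)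
    also have "norm c * h z \<le> norm c * e"
      using hz by (intro mult_left_mono) auto
    finally show "norm (coframe X x v) \<le> (1 + e) * norm (coframe X z v)"
      by (simp add: c_def algebra_simps)
  qed
qed

section \<open>Piecewise C1 curves: induction, concatenation and reparametrization\<close>

text \<open>Strong induction on the number of break points inside the open interval: cutting at a
  break point \<open>c\<close> leaves \<open>c\<close> in neither open half, so both counts
  drop.\<close>

lemma piecewise_C1_curve_induct [consumes 2, case_names C1 join]:
  assumes pc: "piecewise_C1_curve \<gamma> a b" and "a < b"
    and C1: "\<And>s t. a \<le> s \<Longrightarrow> s < t \<Longrightarrow> t \<le> b \<Longrightarrow> C1_curve \<gamma> s t \<Longrightarrow> P s t"
    and join: "\<And>r s t. a \<le> r \<Longrightarrow> r < s \<Longrightarrow> s < t \<Longrightarrow> t \<le> b \<Longrightarrow> P r s \<Longrightarrow> P s t \<Longrightarrow> P r t"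
  shows "P a b"
proof -
  from pc obtain T where T: "finite T"
    "\<And>s t. a \<le> s \<Longrightarrow> s < t \<Longrightarrow> t \<le> b \<Longrightarrow> {s<..<t} \<inter> T = {} \<Longrightarrow> C1_curve \<gamma> s t"
    unfolding piecewise_C1_curve_def by blast
  have "P s t" if "a \<le> s" "s < t" "t \<le> b" for s t
    using that
  proof (induction "card ({s<..<t} \<inter> T)" arbitrary: s t rule: less_induct)
    case less
    show ?case
    proof (cases "{s<..<t} \<inter> T = {}")
      case True
      with T less.prems C1 show ?thesis by blast
    next
      case False
      then obtain c where c: "s < c" "c < t" "c \<in> T" by auto
      have "card ({s<..<c} \<inter> T) < card ({s<..<t} \<inter> T)" "card ({c<..<t} \<inter> T) < card ({s<..<t} \<inter> T)"
        using c T(1) by (auto intro!: psubset_card_mono)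
      with less c join show ?thesis by (meson less_le_trans le_less_trans less_imp_le)
    qed
  qed
  with \<open>a < b\<close> show ?thesis by simp
qed

lemma piecewise_C1_curve_subset:
  assumes "piecewise_C1_curve \<gamma> a b" "a \<le> c" "d \<le> b"
  shows "piecewise_C1_curve \<gamma> c d"
proof -
  have "continuous_on {c..d} \<gamma>"
    using assms by (auto simp: piecewise_C1_curve_def intro: continuous_on_subset)
  with assms show ?thesis
    unfolding piecewise_C1_curve_def by (meson order_trans)
qed

lemma C1_curve_cong:
  assumes "C1_curve \<gamma> s t" "s < t" "\<And>r. s \<le> r \<Longrightarrow> r \<le> t \<Longrightarrow> \<eta> r = \<gamma> r"
  shows "C1_curve \<eta> s t"
proof -
  obtain \<gamma>' where g: "continuous_on {s..t} \<gamma>'"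
    "\<And>r. r \<in> {s..t} \<Longrightarrow> (\<gamma> has_vector_derivative \<gamma>' r) (at r within {s..t})"
    using assms unfolding C1_curve_def by blast
  have "(\<eta> has_vector_derivative \<gamma>' r) (at r within {s..t})" if "r \<in> {s..t}" for r
    by (rule has_vector_derivative_transform[OF that _ g(2)[OF that]]) (use assms in auto)
  with g show ?thesis unfolding C1_curve_def by blast
qed

lemma piecewise_C1_curve_cong:
  assumes "piecewise_C1_curve \<gamma> a b" "\<And>r. a \<le> r \<Longrightarrow> r \<le> b \<Longrightarrow> \<eta> r = \<gamma> r"
  shows "piecewise_C1_curve \<eta> a b"
proof -
  have "continuous_on {a..b} \<eta>"
    using assms by (subst continuous_on_cong[OF refl, of _ _ \<gamma>]) (auto simp: piecewise_C1_curve_def)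
  moreover have "C1_curve \<eta> s t" if "C1_curve \<gamma> s t" "a \<le> s" "s < t" "t \<le> b" for s t
    using C1_curve_cong[OF that(1)] that assms(2) by auto
  ultimately show ?thesis
    using assms(1) unfolding piecewise_C1_curve_def by meson
qed

lemma piecewise_C1_curve_join:
  assumes ab: "piecewise_C1_curve \<gamma> a b" and bc: "piecewise_C1_curve \<gamma> b c"
    and le: "a \<le> b" "b \<le> c"
  shows "piecewise_C1_curve \<gamma> a c"
proof -
  obtain S where S: "finite S"
    "\<And>s t. a \<le> s \<Longrightarrow> s < t \<Longrightarrow> t \<le> b \<Longrightarrow> {s<..<t} \<inter> S = {} \<Longrightarrow> C1_curve \<gamma> s t"
    using ab unfolding piecewise_C1_curve_def by blast
  obtain T where T: "finite T"
    "\<And>s t. b \<le> s \<Longrightarrow> s < t \<Longrightarrow> t \<le> c \<Longrightarrow> {s<..<t} \<inter> T = {} \<Longrightarrow> C1_curve \<gamma> s t"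
    using bc unfolding piecewise_C1_curve_def by blast
  have "continuous_on ({a..b} \<union> {b..c}) \<gamma>"
    using ab bc by (intro continuous_on_closed_Un) (auto simp: piecewise_C1_curve_def)
  then have "continuous_on {a..c} \<gamma>"
    using le by (simp add: ivl_disj_un_two_touch)
  \<comment> \<open>Counting the junction \<open>b\<close> as a break point forces every remaining
    piece to lie on one side of it.\<close>
  moreover have "C1_curve \<gamma> s t"
    if "a \<le> s" "s < t" "t \<le> c" "{s<..<t} \<inter> (insert b (S \<union> T)) = {}" for s t
  proof (cases "t \<le> b")
    case True
    with that S show ?thesis by blast
  next
    case False
    with that have "b \<le> s" by force
    with that T show ?thesis by blast
  qed
  ultimately show ?thesis
    unfolding piecewise_C1_curve_def using S(1) T(1)
    by (intro conjI exI[of _ "insert b (S \<union> T)"]) auto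
qed

text \<open>Affine changes of parameter of either sign suffice: slope 1 shifts a curve for
  concatenation, slope -1 reverses it for symmetry of the distance.\<close>

lemma C1_curve_reparam:
  fixes m k :: real
  assumes C: "C1_curve \<gamma> c d" and m: "m \<noteq> 0"
    and maps: "\<And>r. s \<le> r \<Longrightarrow> r \<le> t \<Longrightarrow> c \<le> m * r + k \<and> m * r + k \<le> d"
  shows "C1_curve (\<lambda>r. \<gamma> (m * r + k)) s t"
proof -
  obtain \<gamma>' where g: "continuous_on {c..d} \<gamma>'"
    "\<And>r. r \<in> {c..d} \<Longrightarrow> (\<gamma> has_vector_derivative \<gamma>' r) (at r within {c..d})"
    using C unfolding C1_curve_def by blast
  show ?thesis
    unfolding C1_curve_def
  proof (intro exI conjI ballI)
    show "continuous_on {s..t} (\<lambda>r. m *\<^sub>R \<gamma>' (m * r + k))"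
      by (intro continuous_intros continuous_on_compose2[OF g(1)]) (use maps in auto)
    fix r assume r: "r \<in> {s..t}"
    have "((\<gamma> \<circ> (\<lambda>r. m * r + k)) has_vector_derivative m *\<^sub>R \<gamma>' (m * r + k)) (at r within {s..t})"
    proof (rule vector_diff_chain_within)
      show "((\<lambda>r. m * r + k) has_vector_derivative m) (at r within {s..t})"
        by (auto intro!: derivative_eq_intros simp flip: has_real_derivative_iff_has_vector_derivative)
      show "(\<gamma> has_vector_derivative \<gamma>' (m * r + k)) (at (m * r + k) within (\<lambda>r. m * r + k) ` {s..t})"
        by (rule has_vector_derivative_within_subset[OF g(2)]) (use maps r in auto)
    qed
    then show "((\<lambda>r. \<gamma> (m * r + k)) has_vector_derivative m *\<^sub>R \<gamma>' (m * r + k)) (at r within {s..t})"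
      by (simp add: o_def)
  qed
qed


lemma piecewise_C1_curve_reparam:
  fixes m k :: real
  assumes pc: "piecewise_C1_curve \<gamma> c d" and m: "m \<noteq> 0"
    and img: "(\<lambda>r. m * r + k) ` {a..b} = {c..d}"
  shows "piecewise_C1_curve (\<lambda>r. \<gamma> (m * r + k)) a b"
proof -
  let ?g = "\<lambda>r. m * r + k"
  obtain T where T: "finite T"
    "\<And>s t. c \<le> s \<Longrightarrow> s < t \<Longrightarrow> t \<le> d \<Longrightarrow> {s<..<t} \<inter> T = {} \<Longrightarrow> C1_curve \<gamma> s t"
    using pc unfolding piecewise_C1_curve_def by blast
  have cont: "continuous_on {a..b} (\<lambda>r. \<gamma> (m * r + k))"
  proof (rule continuous_on_compose2[of "{c..d}" \<gamma> "{a..b}" ?g])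
    show "continuous_on {c..d} \<gamma>" using pc by (simp add: piecewise_C1_curve_def)
    show "continuous_on {a..b} ?g" by (intro continuous_intros)
    show "?g ` {a..b} \<subseteq> {c..d}" using img by (rule equalityD1)
  qed
  have inj: "inj ?g" using m by (auto simp: inj_def)
  have C1: "C1_curve (\<lambda>r. \<gamma> (m * r + k)) s t"
    if st: "a \<le> s" "s < t" "t \<le> b" "{s<..<t} \<inter> (?g -` T) = {}" for s t
  proof -
    have mem: "?g r \<in> {c..d}" if "r \<in> {s..t}" for r
    proof -
      have "?g r \<in> ?g ` {a..b}" using that st by (intro imageI) auto
      then show ?thesis unfolding img .
    qed
    \<comment> \<open>For negative \<open>m\<close> the images of \<open>s\<close> and
      \<open>t\<close> swap order, hence \<open>min\<close> and \<open>max\<close>. A break point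
      strictly between the images would have its preimage strictly between \<open>s\<close> and
      \<open>t\<close>, which is excluded.\<close>
    have e: "\<exists>r. s < r \<and> r < t \<and> ?g r = q"
      if "min (?g s) (?g t) < q" "q < max (?g s) (?g t)" for q
    proof (intro exI conjI)
      let ?r = "(q - k) / m"
      have q: "s < ?r \<and> ?r < t"
      proof (cases "m > 0")
        case True
        then have "m * s < m * t" using \<open>s < t\<close> by simp
        then show ?thesis using that True
          by (simp add: pos_less_divide_eq pos_divide_less_eq mult.commute min_def max_def)
      next
        case False
        then have "m < 0" using m by simp
        then have "m * t < m * s" using \<open>s < t\<close> by simp
        then show ?thesis using that \<open>m < 0\<close>
          by (simp add: neg_less_divide_eq neg_divide_less_eq mult.commute min_def max_def)
      qed
      show "?g ?r = q" using m by simp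
      show "s < ?r" "?r < t"
        using q by simp_all
    qed
    have "C1_curve \<gamma> (min (?g s) (?g t)) (max (?g s) (?g t))"
    proof (rule T(2))
      show "min (?g s) (?g t) < max (?g s) (?g t)" using m st by (auto simp: min_def max_def)
      show "{min (?g s) (?g t)<..<max (?g s) (?g t)} \<inter> T = {}"
        using e st(4) by fastforce
    qed (use mem[of s] mem[of t] st in auto)
    then show ?thesis
    proof (rule C1_curve_reparam[OF _ m])
      fix r assume "s \<le> r" "r \<le> t"
      then have "m * s \<le> m * r \<and> m * r \<le> m * t \<or> m * t \<le> m * r \<and> m * r \<le> m * s"
        by (cases "m > 0") (auto simp: mult_left_mono mult_left_mono_neg)
      then show "min (?g s) (?g t) \<le> ?g r \<and> ?g r \<le> max (?g s) (?g t)"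
        by auto
    qed
  qed
  show ?thesis
    unfolding piecewise_C1_curve_def
    using cont C1 finite_vimageI[OF T(1) inj] by blast
qed

lemma C1_curveE:
  assumes "C1_curve \<gamma> s t"
  obtains \<gamma>' where "continuous_on {s..t} \<gamma>'"
    and "\<And>r. r \<in> {s..t} \<Longrightarrow> (\<gamma> has_vector_derivative \<gamma>' r) (at r within {s..t})"
    and "\<And>r. s < r \<Longrightarrow> r < t \<Longrightarrow> (\<gamma> has_vector_derivative \<gamma>' r) (at r)"
proof -
  obtain \<gamma>' where g: "continuous_on {s..t} \<gamma>'"
    "\<And>r. r \<in> {s..t} \<Longrightarrow> (\<gamma> has_vector_derivative \<gamma>' r) (at r within {s..t})"
    using assms unfolding C1_curve_def by blast
  moreover have "(\<gamma> has_vector_derivative \<gamma>' r) (at r)" if "s < r" "r < t" for r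
    using g(2)[of r] that by (simp add: at_within_Icc_at)
  ultimately show thesis using that by blast
qed

lemma C1_curve_continuous_on:
  "C1_curve \<gamma> s t \<Longrightarrow> continuous_on {s..t} \<gamma>"
  unfolding C1_curve_def continuous_on_eq_continuous_within
  by (meson has_vector_derivative_continuous)

lemma piecewise_C1_curve_differentiable:
  assumes "piecewise_C1_curve \<gamma> a b" "a < b"
  shows "\<exists>T. finite T \<and> (\<forall>t\<in>{a<..<b} - T. \<gamma> differentiable (at t))"
  using assms
proof (induction rule: piecewise_C1_curve_induct)
  case (C1 s t)
  from C1(4) show ?case
    by (rule C1_curveE) (auto intro!: exI[of _ "{}"] differentiableI_vector)
next
  case (join r s t)
  then obtain T U where "finite T" "\<forall>t\<in>{r<..<s} - T. \<gamma> differentiable (at t)"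
    "finite U" "\<forall>t\<in>{s<..<t} - U. \<gamma> differentiable (at t)" by blast
  then show ?case
    by (intro exI[of _ "insert s (T \<union> U)"]) (auto, metis DiffI greaterThanLessThan_iff linorder_neqE_linordered_idom)
qed

section \<open>Speed and length of curves\<close>

text \<open>The two-sided derivative makes the integrand independent of the interval, so that
  lengths over adjacent intervals add up. Inside an interval it agrees with the integrand of
  \<open>frame_length\<close>; only the end points can differ.\<close>

definition frame_speed ::
  "('n::finite \<Rightarrow> real^'n \<Rightarrow> real^'n) \<Rightarrow> (real \<Rightarrow> real^'n) \<Rightarrow> real \<Rightarrow> real" where
  "frame_speed X \<gamma> t = norm (coframe X (\<gamma> t) (vector_derivative \<gamma> (at t)))"

lemma frame_speed_nonneg: "0 \<le> frame_speed X \<gamma> t"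
  by (simp add: frame_speed_def)

lemma frame_length_eq_integral:
  assumes "smooth_frame X"
  shows "frame_length X \<gamma> a b = integral {a..b} (frame_speed X \<gamma>)"
  unfolding frame_length_def
proof (rule integral_spike[of "{a, b}"])
  fix t assume "t \<in> {a..b} - {a, b}"
  then have "at t within {a..b} = at t" by (intro at_within_Icc_at) auto
  then show "frame_speed X \<gamma> t =
      (let v = vector_derivative \<gamma> (at t within {a..b}) in sqrt (frame_metric X (\<gamma> t) v v))"
    by (simp add: frame_speed_def frame_metric_eq_coframe[OF assms] norm_eq_sqrt_inner Let_def)
qed simp

text \<open>This holds for arbitrary curves, since \<open>integral\<close> is 0 for a non-integrable
  speed.\<close>

lemma frame_length_nonneg:
  assumes "smooth_frame X"
  shows "0 \<le> frame_length X \<gamma> a b"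
proof (cases "frame_speed X \<gamma> integrable_on {a..b}")
  case True
  then show ?thesis
    by (simp add: frame_length_eq_integral[OF assms] integral_nonneg frame_speed_nonneg)
next
  case False
  then show ?thesis
    by (simp add: frame_length_eq_integral[OF assms] not_integrable_integral)
qed

text \<open>Argued on the original integrand: the derivative within \<open>{a..b}\<close> sees only
  the values of the curve there, whereas \<open>frame_speed\<close> at an end point also sees values
  outside.\<close>

lemma frame_length_cong:
  assumes "\<And>r. a \<le> r \<Longrightarrow> r \<le> b \<Longrightarrow> \<eta> r = \<gamma> r"
  shows "frame_length X \<eta> a b = frame_length X \<gamma> a b"
  unfolding frame_length_def
proof (rule integral_cong)
  fix t assume t: "t \<in> {a..b}"
  have "vector_derivative \<eta> (at t within {a..b}) = vector_derivative \<gamma> (at t within {a..b})"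
    by (rule vector_derivative_cong_eq) (use assms t in auto)
  then show "(let v = vector_derivative \<eta> (at t within {a..b}) in sqrt (frame_metric X (\<eta> t) v v)) =
      (let v = vector_derivative \<gamma> (at t within {a..b}) in sqrt (frame_metric X (\<gamma> t) v v))"
    using assms t by simp
qed

lemma C1_curve_speed_integrable:
  assumes X: "smooth_frame X" and C: "C1_curve \<gamma> s t"
  shows "frame_speed X \<gamma> integrable_on {s..t}"
proof -
  from C obtain \<gamma>' where g: "continuous_on {s..t} \<gamma>'"
    "\<And>r. s < r \<Longrightarrow> r < t \<Longrightarrow> (\<gamma> has_vector_derivative \<gamma>' r) (at r)" by (metis C1_curveE)
  have "(\<lambda>r. norm (coframe X (\<gamma> r) (\<gamma>' r))) integrable_on {s..t}"
    by (intro integrable_continuous_interval continuous_on_norm continuous_on_coframe[OF X]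
        C1_curve_continuous_on C g)
  then show ?thesis
    by (rule integrable_spike[of _ _ "{s, t}"])
      (use g(2)[THEN vector_derivative_at] in \<open>auto simp: frame_speed_def order.strict_iff_order\<close>)
qed

lemma frame_speed_integrable:
  assumes X: "smooth_frame X" and "piecewise_C1_curve \<gamma> a b"
  shows "frame_speed X \<gamma> integrable_on {a..b}"
proof (cases "a < b")
  case True
  from assms(2) True show ?thesis
  proof (induction rule: piecewise_C1_curve_induct)
    case C1
    with X show ?case by (simp add: C1_curve_speed_integrable)
  next
    case join
    then show ?case by (meson Henstock_Kurzweil_Integration.integrable_combine less_imp_le)
  qed
next
  case False
  then have "finite {a..b}" by (cases "a = b") auto
  then show ?thesis by (intro integrable_negligible negligible_finite)
qed

lemma frame_length_combine:
  assumes X: "smooth_frame X" and "piecewise_C1_curve \<gamma> a c" "a \<le> b" "b \<le> c"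
  shows "frame_length X \<gamma> a c = frame_length X \<gamma> a b + frame_length X \<gamma> b c"
  using frame_speed_integrable[OF X assms(2)] assms(3,4)
  by (simp add: frame_length_eq_integral[OF X] Henstock_Kurzweil_Integration.integral_combine)

lemma norm_coframe_displacement_le:
  assumes X: "smooth_frame X" and "piecewise_C1_curve \<gamma> a b" "a < b"
    and le: "\<And>t v. a \<le> t \<Longrightarrow> t \<le> b \<Longrightarrow>
               norm (coframe X x v) \<le> K * norm (coframe X (\<gamma> t) v)"
  shows "norm (coframe X x (\<gamma> b - \<gamma> a)) \<le> K * frame_length X \<gamma> a b"
proof -
  note lin = linear_coframe[OF X, of x]
  \<comment> \<open>Integrability is carried through the induction because the joining case combines
    the integrals of the two pieces.\<close>
  have "frame_speed X \<gamma> integrable_on {a..b} \<and>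
      norm (coframe X x (\<gamma> b - \<gamma> a)) \<le> K * integral {a..b} (frame_speed X \<gamma>)"
    using assms(2,3)
  proof (induction rule: piecewise_C1_curve_induct)
    case (C1 s t)
    from C1(4) obtain \<gamma>' where g: "continuous_on {s..t} \<gamma>'"
      "\<And>r. r \<in> {s..t} \<Longrightarrow> (\<gamma> has_vector_derivative \<gamma>' r) (at r within {s..t})"
      "\<And>r. s < r \<Longrightarrow> r < t \<Longrightarrow> (\<gamma> has_vector_derivative \<gamma>' r) (at r)" by (metis C1_curveE)
    have int: "frame_speed X \<gamma> integrable_on {s..t}"
      by (rule C1_curve_speed_integrable[OF X C1(4)])
    have bl: "bounded_linear (coframe X x)"
      using lin by (simp add: linear_conv_bounded_linear)
    have "((\<lambda>r. coframe X x (\<gamma>' r)) has_integral coframe X x (\<gamma> t) - coframe X x (\<gamma> s)) {s..t}"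
      using C1(2) by (intro fundamental_theorem_of_calculus bounded_linear.has_vector_derivative[OF bl] g(2)) auto
    then have fi: "((\<lambda>r. coframe X x (\<gamma>' r)) has_integral coframe X x (\<gamma> t - \<gamma> s)) {s..t}"
      by (simp add: linear_diff[OF lin])
    have Kint: "(\<lambda>r. K * norm (coframe X (\<gamma> r) (\<gamma>' r))) integrable_on {s..t}"
      by (intro integrable_continuous_interval continuous_intros continuous_on_coframe[OF X]
        C1_curve_continuous_on C1(4) g)
    have "norm (integral {s..t} (\<lambda>r. coframe X x (\<gamma>' r)))
        \<le> integral {s..t} (\<lambda>r. K * norm (coframe X (\<gamma> r) (\<gamma>' r)))"
      using fi le C1 by (intro integral_norm_bound_integral Kint) auto
    also have "\<dots> = integral {s..t} (\<lambda>r. K * frame_speed X \<gamma> r)"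
      by (rule integral_spike[of "{s, t}"])
        (use g(3)[THEN vector_derivative_at] in \<open>auto simp: frame_speed_def order.strict_iff_order\<close>)
    finally show ?case using fi int by (auto simp: integral_unique)
  next
    case (join r s t)
    then have int: "frame_speed X \<gamma> integrable_on {r..t}"
      by (meson Henstock_Kurzweil_Integration.integrable_combine less_imp_le)
    have "norm (coframe X x (\<gamma> t - \<gamma> r)) \<le> norm (coframe X x (\<gamma> t - \<gamma> s)) + norm (coframe X x (\<gamma> s - \<gamma> r))"
      using norm_triangle_ineq[of "coframe X x (\<gamma> t - \<gamma> s)" "coframe X x (\<gamma> s - \<gamma> r)"]
      by (simp flip: linear_add[OF lin])
    also have "\<dots> \<le> K * (integral {r..s} (frame_speed X \<gamma>) + integral {s..t} (frame_speed X \<gamma>))"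
      using join by (simp add: algebra_simps)
    also have "\<dots> = K * integral {r..t} (frame_speed X \<gamma>)"
      using join int by (simp add: Henstock_Kurzweil_Integration.integral_combine)
    finally show ?case using int by blast
  qed
  then show ?thesis by (simp add: frame_length_eq_integral[OF X])
qed

text \<open>The Jacobian factor \<open>1 / \<bar>m\<bar>\<close> of the affine substitution cancels
  the factor \<open>\<bar>m\<bar>\<close> that the chain rule puts on the speed. The chain rule is
  applied off a finite set: the preimages of the end points and of the points where
  \<open>\<gamma>\<close> may fail to be differentiable.\<close>

lemma frame_length_reparam:
  fixes m k :: real
  assumes X: "smooth_frame X" and pc: "piecewise_C1_curve \<gamma> c d" and "c < d" and m: "m \<noteq> 0"
    and img: "(\<lambda>r. m * r + k) ` {a..b} = {c..d}"
  shows "frame_length X (\<lambda>r. \<gamma> (m * r + k)) a b = frame_length X \<gamma> c d"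
proof -
  let ?g = "\<lambda>r. m * r + k" and ?h = "\<lambda>q. (1 / m) *\<^sub>R q + - ((1 / m) *\<^sub>R k)"
  obtain T where T: "finite T" "\<And>t. c < t \<Longrightarrow> t < d \<Longrightarrow> t \<notin> T \<Longrightarrow> \<gamma> differentiable (at t)"
    using piecewise_C1_curve_differentiable[OF pc \<open>c < d\<close>] by auto
  have inj: "inj ?g" using m by (auto simp: inj_def)
  have "?h ` {c..d} = {a..b}"
    unfolding img[symmetric] image_image using m by (simp add: add_divide_distrib)
  moreover have "(frame_speed X \<gamma> has_integral integral {c..d} (frame_speed X \<gamma>)) (cbox c d)"
    using frame_speed_integrable[OF X pc] by (simp add: integrable_integral)
  ultimately have "((\<lambda>r. frame_speed X \<gamma> (m * r + k)) has_integral
      (1 / \<bar>m\<bar>) * integral {c..d} (frame_speed X \<gamma>)) {a..b}"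
    using has_integral_affinity[OF _ m, of "frame_speed X \<gamma>" _ c d k] by simp
  from has_integral_mult_right[OF this, of "\<bar>m\<bar>"]
  have "((\<lambda>r. \<bar>m\<bar> * frame_speed X \<gamma> (m * r + k)) has_integral
      integral {c..d} (frame_speed X \<gamma>)) {a..b}"
    using m by simp
  then have "(frame_speed X (\<lambda>r. \<gamma> (m * r + k)) has_integral
      integral {c..d} (frame_speed X \<gamma>)) {a..b}"
  proof (rule has_integral_spike_finite[rotated 2])
    show "finite (?g -` ({c, d} \<union> T))"
      using T(1) by (intro finite_vimageI inj) auto
    fix r assume r: "r \<in> {a..b} - ?g -` ({c, d} \<union> T)"
    then have "?g r \<in> {c..d}" using img by blast
    with r have "c < ?g r" "?g r < d" "?g r \<notin> T" by auto
    then have "(\<gamma> has_vector_derivative vector_derivative \<gamma> (at (?g r))) (at (?g r))"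
      using T(2) vector_derivative_works by blast
    then have "((\<gamma> \<circ> ?g) has_vector_derivative m *\<^sub>R vector_derivative \<gamma> (at (?g r))) (at r)"
      by (intro vector_diff_chain_at)
        (auto intro!: derivative_eq_intros simp flip: has_real_derivative_iff_has_vector_derivative)
    then have "vector_derivative (\<lambda>r. \<gamma> (m * r + k)) (at r) = m *\<^sub>R vector_derivative \<gamma> (at (?g r))"
      by (simp add: o_def vector_derivative_at)
    then show "frame_speed X (\<lambda>r. \<gamma> (m * r + k)) r = \<bar>m\<bar> * frame_speed X \<gamma> (m * r + k)"
      by (simp add: frame_speed_def linear_cmul[OF linear_coframe[OF X]])
  qed
  then show ?thesis
    by (simp add: frame_length_eq_integral[OF X] integral_unique)
qed

section \<open>The distance: approximation by curves, symmetry and the triangle inequality\<close>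

lemma frame_dist_le:
  assumes X: "smooth_frame X" and "a < b" "piecewise_C1_curve \<gamma> a b"
  shows "frame_dist X (\<gamma> a) (\<gamma> b) \<le> frame_length X \<gamma> a b"
  unfolding frame_dist_def
proof (rule cInf_lower)
  show "bdd_below {frame_length X \<eta> s t |\<eta> s t.
      s < t \<and> piecewise_C1_curve \<eta> s t \<and> \<eta> s = \<gamma> a \<and> \<eta> t = \<gamma> b}"
    using frame_length_nonneg[OF X] by (intro bdd_belowI[of _ 0]) auto
qed (use assms in blast)

lemma piecewise_C1_curve_line:
  fixes x v :: "'a::real_normed_vector"
  shows "piecewise_C1_curve (\<lambda>s. x + s *\<^sub>R v) a b"
proof -
  have "C1_curve (\<lambda>s. x + s *\<^sub>R v) s t" for s t
    unfolding C1_curve_def by (intro exI[of _ "\<lambda>_. v"]) (auto intro!: derivative_eq_intros)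
  then show ?thesis
    unfolding piecewise_C1_curve_def by (auto intro!: continuous_intros)
qed

text \<open>The straight segment shows that the infimum is over a nonempty set, so curves come
  arbitrarily close to it.\<close>

lemma frame_dist_lessD:
  assumes "frame_dist X x y < c"
  obtains \<gamma> a b where "a < b" "piecewise_C1_curve \<gamma> a b" "\<gamma> a = x" "\<gamma> b = y"
    "frame_length X \<gamma> a b < c"
proof -
  let ?S = "{frame_length X \<gamma> a b |\<gamma> a b.
            a < b \<and> piecewise_C1_curve \<gamma> a b \<and> \<gamma> a = x \<and> \<gamma> b = y}"
  have "frame_length X (\<lambda>s. x + s *\<^sub>R (y - x)) 0 1 \<in> ?S"
    using piecewise_C1_curve_line[of x "y - x" 0 1]
    by (intro CollectI exI[of _ 0] exI[of _ 1] exI[of _ "\<lambda>s. x + s *\<^sub>R (y - x)"]) auto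
  then have "?S \<noteq> {}" by blast
  from cInf_lessD[OF this] show thesis
    using assms that unfolding frame_dist_def by blast
qed

lemma frame_dist_commute_le:
  assumes X: "smooth_frame X"
  shows "frame_dist X y x \<le> frame_dist X x y"
proof (rule field_le_epsilon)
  fix e :: real assume "e > 0"
  then have "frame_dist X x y < frame_dist X x y + e" by simp
  then obtain \<gamma> a b where g: "a < b" "piecewise_C1_curve \<gamma> a b" "\<gamma> a = x" "\<gamma> b = y"
    "frame_length X \<gamma> a b < frame_dist X x y + e"
    by (rule frame_dist_lessD)
  \<comment> \<open>Reversal, written as an affine map to fit the reparametrization lemmas.\<close>
  have img: "(\<lambda>r. (- 1) * r + 0) ` {- b..- a} = {a..b}" by simp
  have "frame_dist X y x \<le> frame_length X (\<lambda>r. \<gamma> ((- 1) * r + 0)) (- b) (- a)"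
    using frame_dist_le[OF X _ piecewise_C1_curve_reparam[OF g(2) _ img]] g by simp
  also have "\<dots> = frame_length X \<gamma> a b"
    by (rule frame_length_reparam[OF X g(2,1) _ img]) simp
  finally show "frame_dist X y x \<le> frame_dist X x y + e" using g by simp
qed

lemma frame_dist_commute:
  "smooth_frame X \<Longrightarrow> frame_dist X y x = frame_dist X x y"
  by (simp add: antisym frame_dist_commute_le)

lemma frame_dist_triangle:
  assumes X: "smooth_frame X"
  shows "frame_dist X x z \<le> frame_dist X x y + frame_dist X y z"
proof (rule field_le_epsilon)
  fix e :: real assume "e > 0"
  then have e: "frame_dist X x y < frame_dist X x y + e / 2" "frame_dist X y z < frame_dist X y z + e / 2"
    by simp_all
  from e(1) obtain \<gamma> a b where g: "a < b" "piecewise_C1_curve \<gamma> a b" "\<gamma> a = x" "\<gamma> b = y"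
    "frame_length X \<gamma> a b < frame_dist X x y + e / 2"
    by (rule frame_dist_lessD)
  from e(2) obtain \<eta> c d where h: "c < d" "piecewise_C1_curve \<eta> c d" "\<eta> c = y" "\<eta> d = z"
    "frame_length X \<eta> c d < frame_dist X y z + e / 2"
    by (rule frame_dist_lessD)
  define f where "f = b + (d - c)"
  have bf: "b < f" using h by (simp add: f_def)
  have img: "(\<lambda>r. 1 * r + (c - b)) ` {b..f} = {c..d}"
    using image_add_atLeastAtMost[of "c - b" b f] by (simp add: f_def add.commute algebra_simps)
  \<comment> \<open>The second curve is shifted to start at time \<open>b\<close>. Both branches
    take the value \<open>y\<close> there, which is why \<open>\<zeta>\<close> follows the second
    branch on the closed interval from \<open>b\<close> to \<open>f\<close>.\<close>
  define \<zeta> where "\<zeta> r = (if r \<le> b then \<gamma> r else \<eta> (1 * r + (c - b)))" for r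
  have 1: "\<And>r. a \<le> r \<Longrightarrow> r \<le> b \<Longrightarrow> \<zeta> r = \<gamma> r" by (simp add: \<zeta>_def)
  have 2: "\<And>r. b \<le> r \<Longrightarrow> r \<le> f \<Longrightarrow> \<zeta> r = \<eta> (1 * r + (c - b))" using g h by (auto simp: \<zeta>_def)
  have "piecewise_C1_curve \<zeta> a b" using g(2) 1 by (rule piecewise_C1_curve_cong)
  moreover have "piecewise_C1_curve \<zeta> b f"
    by (rule piecewise_C1_curve_cong[OF piecewise_C1_curve_reparam[OF h(2) _ img] 2]) auto
  ultimately have pc: "piecewise_C1_curve \<zeta> a f"
    using g bf by (intro piecewise_C1_curve_join[of _ a b f]) auto
  have "frame_dist X x z \<le> frame_length X \<zeta> a f"
    using frame_dist_le[OF X _ pc] g h bf by (simp add: \<zeta>_def f_def)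
  also have "\<dots> = frame_length X \<zeta> a b + frame_length X \<zeta> b f"
    using g bf by (intro frame_length_combine[OF X pc]) auto
  also have "frame_length X \<zeta> a b = frame_length X \<gamma> a b" using 1 by (rule frame_length_cong)
  also have "frame_length X \<zeta> b f = frame_length X (\<lambda>r. \<eta> (1 * r + (c - b))) b f"
    using 2 by (rule frame_length_cong)
  also have "\<dots> = frame_length X \<eta> c d"
    by (rule frame_length_reparam[OF X h(2,1) _ img]) simp
  finally show "frame_dist X x z \<le> frame_dist X x y + frame_dist X y z + e"
    using g h by simp
qed

section \<open>Positivity of the distance and the eikonal equation\<close>

text \<open>Cut a nearly minimizing curve at the crossing point \<open>z\<close>. The first part has
  length at least \<open>r / (1 + e)\<close> by comparison of metrics, and the rest at least the
  distance from \<open>z\<close> to \<open>y\<close>. The excess \<open>e * r\<close> is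
  proportional to \<open>r\<close>, so it stays small after division by \<open>r\<close>.\<close>

lemma frame_dist_sphere_crossing:
  fixes X :: "'n::finite \<Rightarrow> real^'n \<Rightarrow> real^'n"
  assumes X: "smooth_frame X" and "x \<noteq> y" and e: "0 < e"
  obtains \<delta> where "0 < \<delta>"
    and "\<And>r. 0 < r \<Longrightarrow> r \<le> \<delta> \<Longrightarrow> \<exists>z. norm (coframe X x (z - x)) = r \<and>
           r \<le> (1 + e) * (frame_dist X x y - frame_dist X z y + e * r)"
proof -
  obtain \<delta>0 where d0: "0 < \<delta>0"
    "\<And>z v. norm (coframe X x (z - x)) \<le> \<delta>0 \<Longrightarrow>
       norm (coframe X x v) \<le> (1 + e) * norm (coframe X z v)"
    using coframe_comparison[OF X e] by blast
  define R where "R = norm (coframe X x (y - x))"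
  have "R > 0" using \<open>x \<noteq> y\<close> by (simp add: R_def coframe_eq_0_iff[OF X])
  show thesis
  proof
    \<comment> \<open>The bound \<open>\<delta>0\<close> keeps the metrics comparable, and
      \<open>R / 2\<close> leaves \<open>y\<close> outside the sphere, so that every curve to
      \<open>y\<close> must cross it.\<close>
    show "0 < min \<delta>0 (R / 2)" using d0 \<open>R > 0\<close> by simp
    fix r assume r: "0 < r" "r \<le> min \<delta>0 (R / 2)"
    have "frame_dist X x y < frame_dist X x y + e * r" using r e by simp
    then obtain \<gamma> a b where g: "a < b" "piecewise_C1_curve \<gamma> a b" "\<gamma> a = x" "\<gamma> b = y"
      "frame_length X \<gamma> a b < frame_dist X x y + e * r"
      by (rule frame_dist_lessD)
    \<comment> \<open>Stopping at the first hitting time keeps the curve where the metrics are comparable.\<close>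
    define N where "N t = norm (coframe X x (\<gamma> t - x))" for t
    have "continuous_on {a..b} \<gamma>" using g(2) by (simp add: piecewise_C1_curve_def)
    then have contN: "continuous_on {a..b} N"
      unfolding N_def by (intro continuous_intros continuous_on_coframe[OF X])
    have Na: "N a = 0" by (simp add: N_def g coframe_eq_0_iff[OF X])
    have Nb: "N b = R" by (simp add: N_def g R_def)
    have "closed ({a..b} \<inter> N -` {r..})"
      by (rule continuous_closed_preimage[OF contN]) auto
    then have "compact ({a..b} \<inter> ({a..b} \<inter> N -` {r..}))"
      by (intro compact_Int_closed) auto
    then have "compact ({a..b} \<inter> N -` {r..})" by simp
    moreover have "b \<in> {a..b} \<inter> N -` {r..}"
      using g Nb r \<open>R > 0\<close> by auto
    ultimately obtain t where "t \<in> {a..b} \<inter> N -` {r..}"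
      and "\<forall>s\<in>{a..b} \<inter> N -` {r..}. t \<le> s"
      using compact_attains_inf[of "{a..b} \<inter> N -` {r..}"] by blast
    then have t: "a \<le> t" "t \<le> b" "r \<le> N t"
      and tmin: "\<And>s. a \<le> s \<Longrightarrow> s \<le> b \<Longrightarrow> r \<le> N s \<Longrightarrow> t \<le> s"
      by auto
    have Nt: "N t = r"
    proof -
      \<comment> \<open>The intermediate value theorem gives a time up to \<open>t\<close> with
        value exactly \<open>r\<close>; minimality of \<open>t\<close> makes it \<open>t\<close>
        itself.\<close>
      obtain s where "a \<le> s" "s \<le> t" "N s = r"
        using IVT'[of N a r t] t r Na continuous_on_subset[OF contN] by auto
      with tmin[of s] t show ?thesis by force
    qed
    have "a < t" using Nt Na r t by (cases "a = t") auto
    have "t < b" using Nt Nb r t \<open>R > 0\<close> by (cases "b = t") auto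
    have inside: "N s \<le> \<delta>0" if "a \<le> s" "s \<le> t" for s
      using tmin[of s] that t Nt r by (cases "s = t") force+
    have pc: "piecewise_C1_curve \<gamma> a t" "piecewise_C1_curve \<gamma> t b"
      using piecewise_C1_curve_subset[OF g(2)] t by auto
    have "r = norm (coframe X x (\<gamma> t - \<gamma> a))" using Nt by (simp add: N_def g)
    also have "\<dots> \<le> (1 + e) * frame_length X \<gamma> a t"
      using norm_coframe_displacement_le[OF X pc(1) \<open>a < t\<close>, of x "1 + e"] d0(2) inside
      by (auto simp: N_def)
    also have "\<dots> \<le> (1 + e) * (frame_dist X x y - frame_dist X (\<gamma> t) y + e * r)"
    proof (rule mult_left_mono)
      have "frame_dist X (\<gamma> t) y \<le> frame_length X \<gamma> t b"
        using frame_dist_le[OF X \<open>t < b\<close> pc(2)] g by simp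
      then show "frame_length X \<gamma> a t \<le> frame_dist X x y - frame_dist X (\<gamma> t) y + e * r"
        using frame_length_combine[OF X g(2) t(1,2)] g(5) by simp
    qed (use e in simp)
    finally show "\<exists>z. norm (coframe X x (z - x)) = r \<and>
        r \<le> (1 + e) * (frame_dist X x y - frame_dist X z y + e * r)"
      using Nt by (auto simp: N_def)
  qed
qed

lemma frame_dist_nonneg:
  assumes "smooth_frame X"
  shows "0 \<le> frame_dist X x y"
proof (rule field_le_epsilon)
  fix e :: real assume "e > 0"
  then have "frame_dist X x y < frame_dist X x y + e" by simp
  then show "0 \<le> frame_dist X x y + e"
    by (rule frame_dist_lessD) (meson assms frame_length_nonneg less_imp_le order_trans)
qed

text \<open>Take \<open>e = 1 / 2\<close> and \<open>r = \<delta>\<close> in the crossing estimate.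
  As the distance from \<open>z\<close> to \<open>y\<close> is nonnegative, the distance from
  \<open>x\<close> to \<open>y\<close> is at least \<open>\<delta> / 6\<close>.\<close>

lemma frame_dist_pos:
  assumes X: "smooth_frame X" and "x \<noteq> y"
  shows "0 < frame_dist X x y"
proof -
  have "(0::real) < 1 / 2" by simp
  then obtain \<delta> where d: "0 < \<delta>"
    and c: "\<And>r. 0 < r \<Longrightarrow> r \<le> \<delta> \<Longrightarrow> \<exists>z. norm (coframe X x (z - x)) = r \<and>
           r \<le> (1 + 1 / 2) * (frame_dist X x y - frame_dist X z y + 1 / 2 * r)"
    using frame_dist_sphere_crossing[OF assms] by blast
  from c[OF d order_refl] obtain z
    where "\<delta> \<le> (1 + 1 / 2) * (frame_dist X x y - frame_dist X z y + 1 / 2 * \<delta>)" by blast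
  moreover have "0 \<le> frame_dist X z y" by (rule frame_dist_nonneg[OF X])
  ultimately show ?thesis using d by (simp add: algebra_simps)
qed

lemma frame_dist_derivative_le:
  assumes X: "smooth_frame X"
    and L: "((\<lambda>z. frame_dist X z y) has_derivative L) (at x)"
  shows "L v \<le> norm (coframe X x v)"
proof (rule field_le_epsilon)
  fix e :: real assume e: "e > 0"
  \<comment> \<open>The one-sided estimate is for the decrease of the distance along \<open>- v\<close>.\<close>
  define w where "w = - v"
  have "continuous_on UNIV (\<lambda>s::real. norm (coframe X (x + s *\<^sub>R w) w))"
    by (intro continuous_intros continuous_on_coframe[OF X])
  then obtain \<delta> where d: "\<delta> > 0"
    "\<And>s::real. \<bar>s\<bar> < \<delta> \<Longrightarrow> \<bar>norm (coframe X (x + s *\<^sub>R w) w) - norm (coframe X x w)\<bar> < e"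
    using e unfolding continuous_on_iff
    by (elim ballE[of _ _ 0]) (auto simp: dist_real_def)
  have upper: "frame_dist X x y - frame_dist X (x + t *\<^sub>R w) y \<le> t * (norm (coframe X x w) + e)"
    if t: "0 < t" "t < \<delta>" for t
  proof -
    let ?\<gamma> = "\<lambda>s. x + s *\<^sub>R w"
    have pc: "piecewise_C1_curve ?\<gamma> 0 t" by (rule piecewise_C1_curve_line)
    have "frame_speed X ?\<gamma> s \<le> norm (coframe X x w) + e" if "s \<in> {0..t}" for s
    proof -
      have "(?\<gamma> has_vector_derivative w) (at s)"
        by (auto intro!: derivative_eq_intros)
      then show ?thesis
        using d(2)[of s] that t by (simp add: frame_speed_def vector_derivative_at)
    qed
    then have "frame_length X ?\<gamma> 0 t \<le> integral {0..t} (\<lambda>s. norm (coframe X x w) + e)"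
      unfolding frame_length_eq_integral[OF X]
      by (intro integral_le frame_speed_integrable[OF X pc]) auto
    also have "\<dots> = t * (norm (coframe X x w) + e)" using t by simp
    finally show ?thesis
      using frame_dist_le[OF X t(1) pc] frame_dist_triangle[OF X, of x y "x + t *\<^sub>R w"] by simp
  qed
  have "((\<lambda>t. frame_dist X (x + t *\<^sub>R w) y) has_real_derivative L w) (at 0)"
  proof -
    have "((\<lambda>t::real. x + t *\<^sub>R w) has_derivative (\<lambda>t. t *\<^sub>R w)) (at 0)"
      by (auto intro!: derivative_eq_intros)
    from has_derivative_compose[OF this, of "\<lambda>z. frame_dist X z y" L] L
    have "((\<lambda>t. frame_dist X (x + t *\<^sub>R w) y) has_derivative (\<lambda>t. L (t *\<^sub>R w))) (at 0)" by simp
    moreover have "(\<lambda>t. L (t *\<^sub>R w)) = (*) (L w)"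
      using has_derivative_linear[OF L] by (auto simp: linear_cmul)
    ultimately show ?thesis by (simp add: has_field_derivative_def)
  qed
  \<comment> \<open>Only positive \<open>t\<close> are used, since the segment estimate is divided
    by \<open>t\<close>.\<close>
  then have "((\<lambda>t. (frame_dist X (x + t *\<^sub>R w) y - frame_dist X x y) / t) \<longlongrightarrow> L w) (at_right 0)"
    unfolding DERIV_def using tendsto_mono[OF at_le[OF subset_UNIV]] by force
  moreover have "\<forall>\<^sub>F t in at_right 0.
      - (norm (coframe X x w) + e) \<le> (frame_dist X (x + t *\<^sub>R w) y - frame_dist X x y) / t"
    unfolding eventually_at_right_field
    using d(1) upper by (force simp: field_simps)
  ultimately have "- (norm (coframe X x w) + e) \<le> L w"
    by (intro tendsto_lowerbound) auto
  moreover have "L w = - L v" "coframe X x w = - coframe X x v"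
    using has_derivative_linear[OF L] linear_coframe[OF X, of x]
    by (simp_all add: w_def linear_neg)
  ultimately show "L v \<le> norm (coframe X x v) + e" by simp
qed

text \<open>The vector \<open>l\<close> is the frame gradient, so \<open>L v\<close> is its inner
  product with the coefficients of \<open>v\<close>. Testing the derivative bound on the vector with
  coefficients \<open>l\<close> gives \<open>norm l \<le> 1\<close>. Conversely, first-order
  expansion at the crossing points forces a decrease of almost \<open>r\<close> at metric distance
  \<open>r\<close>.\<close>

lemma frame_dist_eikonal:
  fixes X :: "'n::finite \<Rightarrow> real^'n \<Rightarrow> real^'n"
  assumes X: "smooth_frame X" and "x \<noteq> y"
    and L: "((\<lambda>z. frame_dist X z y) has_derivative L) (at x)"
  shows "(\<Sum>i\<in>UNIV. (L (X i x))\<^sup>2) = 1"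
proof -
  note lin = has_derivative_linear[OF L]
  define l :: "real^'n" where "l = (\<chi> i. L (X i x))"
  have Ll: "L v = l \<bullet> coframe X x v" for v
  proof -
    have "L v = L (\<Sum>i\<in>UNIV. (coframe X x v $ i) *\<^sub>R X i x)"
      by (simp add: frame_expansion[OF X])
    also have "\<dots> = l \<bullet> coframe X x v"
      by (simp add: linear_sum[OF lin] linear_cmul[OF lin] l_def inner_vec_def mult.commute)
    finally show ?thesis .
  qed
  have "norm l \<le> 1"
  proof -
    have "l \<bullet> l \<le> norm l"
      using frame_dist_derivative_le[OF X L, of "\<Sum>i\<in>UNIV. (l $ i) *\<^sub>R X i x"]
      by (simp add: Ll coframe_combination[OF X])
    then have "norm l * norm l \<le> norm l * 1" by (simp add: power2_norm_eq_inner flip: power2_eq_square)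
    then show ?thesis by (cases "l = 0") (auto simp: mult_le_cancel_left)
  qed
  moreover have "1 \<le> norm l"
  proof (rule field_le_epsilon)
    fix e' :: real assume "e' > 0"
    \<comment> \<open>The final estimate is \<open>1 - e \<le> norm l + 2 * e\<close>, a total loss
      of \<open>3 * e\<close>.\<close>
    define e where "e = e' / 3"
    have e: "e > 0" using \<open>e' > 0\<close> by (simp add: e_def)
    obtain B where B: "0 < B" "\<And>v. norm v \<le> B * norm (coframe X x v)"
      using norm_le_coframe[OF X, of x] by blast
    obtain \<delta> where d: "0 < \<delta>"
      and cross: "\<And>r. 0 < r \<Longrightarrow> r \<le> \<delta> \<Longrightarrow> \<exists>z. norm (coframe X x (z - x)) = r \<and>
           r \<le> (1 + e) * (frame_dist X x y - frame_dist X z y + e * r)"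
      using frame_dist_sphere_crossing[OF X \<open>x \<noteq> y\<close> e] by blast
    \<comment> \<open>The remainder is bounded through the Euclidean norm, which is at most
      \<open>B * r\<close>; dividing by \<open>B\<close> makes it at most
      \<open>e * r\<close>.\<close>
    have "e / B > 0" using e B by simp
    with L obtain \<rho> where rho: "\<rho> > 0" "\<And>z. norm (z - x) < \<rho> \<Longrightarrow>
        norm (frame_dist X z y - frame_dist X x y - L (z - x)) \<le> e / B * norm (z - x)"
      unfolding has_derivative_at_alt by blast
    \<comment> \<open>The second bound puts \<open>z\<close> within Euclidean distance
      \<open>\<rho>\<close> of \<open>x\<close>, where the linear approximation is valid.\<close>
    define r where "r = min \<delta> (\<rho> / (2 * B))"
    have r: "0 < r" "r \<le> \<delta>" using d rho B by (auto simp: r_def)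
    from cross[OF r] obtain z where z: "norm (coframe X x (z - x)) = r"
      and zd: "r \<le> (1 + e) * (frame_dist X x y - frame_dist X z y + e * r)" by blast
    have nz: "norm (z - x) \<le> B * r" using B(2)[of "z - x"] z by simp
    also have "B * r \<le> B * (\<rho> / (2 * B))" using B by (intro mult_left_mono) (auto simp: r_def)
    also have "\<dots> < \<rho>" using rho B by simp
    finally have "norm (frame_dist X z y - frame_dist X x y - L (z - x)) \<le> e / B * norm (z - x)"
      by (rule rho)
    also have "\<dots> \<le> e / B * (B * r)" using nz e B by (intro mult_left_mono) auto
    also have "\<dots> = e * r" using B by simp
    finally have "frame_dist X x y - frame_dist X z y \<le> - L (z - x) + e * r" by simp
    also have "- L (z - x) \<le> norm l * r"
      using Cauchy_Schwarz_ineq2[of l "coframe X x (z - x)"] z by (simp add: Ll)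
    finally have A: "frame_dist X x y - frame_dist X z y + e * r \<le> (norm l + 2 * e) * r"
      by (simp add: algebra_simps)
    have "r \<le> (1 + e) * ((norm l + 2 * e) * r)"
      using zd mult_left_mono[OF A, of "1 + e"] e by linarith
    then have "1 \<le> (1 + e) * (norm l + 2 * e)"
      using r by (metis mult.assoc mult_le_cancel_right1 less_le_not_le)
    \<comment> \<open>Replacing 1 by this smaller product allows the factor \<open>1 + e\<close> to
      be cancelled.\<close>
    moreover have "(1 - e) * (1 + e) \<le> 1 * 1"
      using e by (simp add: algebra_simps)
    ultimately have "(1 + e) * (1 - e) \<le> (1 + e) * (norm l + 2 * e)" by (simp add: mult.commute)
    then have "1 - e \<le> norm l + 2 * e" using e by (simp add: mult_le_cancel_left)
    then show "1 \<le> norm l + e'" by (simp add: e_def)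
  qed
  ultimately have "norm l = 1" by simp
  then have "l \<bullet> l = 1" by (simp flip: power2_norm_eq_inner)
  then show ?thesis by (simp add: l_def inner_vec_def power2_eq_square)
qed

section \<open>The doubled frame as vector fields on the product space\<close>

text \<open>For differentiable functions \<open>doubled_deriv\<close> is the total derivative along
  these fields, so the Hessian computation can treat both variables uniformly.\<close>

fun doubled_field ::
  "('n::finite \<Rightarrow> real^'n \<Rightarrow> real^'n) \<Rightarrow> 'n + 'n \<Rightarrow> (real^'n) \<times> (real^'n) \<Rightarrow> (real^'n) \<times> (real^'n)" where
  "doubled_field X (Inl i) (x, y) = (X i x, 0)"
| "doubled_field X (Inr i) (x, y) = (0, X i y)"

lemma has_derivative_fst_slot:
  assumes "(f has_derivative f') (at (x, y))"
  shows "((\<lambda>x. f (x, y)) has_derivative (\<lambda>h. f' (h, 0))) (at x)"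
proof -
  have "((\<lambda>x. (x, y)) has_derivative (\<lambda>h. (h, 0))) (at x)"
    by (auto intro!: derivative_eq_intros)
  from has_derivative_compose[OF this assms] show ?thesis .
qed

lemma has_derivative_snd_slot:
  assumes "(f has_derivative f') (at (x, y))"
  shows "((\<lambda>y. f (x, y)) has_derivative (\<lambda>h. f' (0, h))) (at y)"
proof -
  have "((\<lambda>y. (x, y)) has_derivative (\<lambda>h. (0, h))) (at y)"
    by (auto intro!: derivative_eq_intros)
  from has_derivative_compose[OF this assms] show ?thesis .
qed

lemma doubled_deriv_eq:
  assumes "(f has_derivative f') (at p)"
  shows "doubled_deriv X k f p = f' (doubled_field X k p)"
proof -
  obtain x y where p: "p = (x, y)" by (cases p)
  show ?thesis
    using has_derivative_fst_slot[OF assms[unfolded p]] has_derivative_snd_slot[OF assms[unfolded p]]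
    by (cases k) (simp_all add: p vf_deriv_def frechet_derivative_at[symmetric])
qed

lemma doubled_field_differentiable:
  assumes X: "smooth_frame X"
  shows "doubled_field X k differentiable (at p)"
proof (cases k)
  case (Inl i)
  obtain D where "(X i has_derivative D) (at (fst p))"
    using smooth_frame_differentiable[OF X] unfolding differentiable_def by blast
  then have "((\<lambda>p. X i (fst p)) has_derivative (\<lambda>h. D (fst h))) (at p)"
    by (rule has_derivative_compose[OF bounded_linear_imp_has_derivative[OF bounded_linear_fst]])
  then have "((\<lambda>p. (X i (fst p), 0)) has_derivative (\<lambda>h. (D (fst h), 0))) (at p)"
    by (rule has_derivative_Pair[OF _ has_derivative_const])
  moreover have "doubled_field X k = (\<lambda>p. (X i (fst p), 0))" by (auto simp: Inl)
  ultimately show ?thesis unfolding differentiable_def by auto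
next
  case (Inr i)
  obtain D where "(X i has_derivative D) (at (snd p))"
    using smooth_frame_differentiable[OF X] unfolding differentiable_def by blast
  then have "((\<lambda>p. X i (snd p)) has_derivative (\<lambda>h. D (snd h))) (at p)"
    by (rule has_derivative_compose[OF bounded_linear_imp_has_derivative[OF bounded_linear_snd]])
  then have "((\<lambda>p. (0, X i (snd p))) has_derivative (\<lambda>h. (0, D (snd h)))) (at p)"
    by (rule has_derivative_Pair[OF has_derivative_const _])
  moreover have "doubled_field X k = (\<lambda>p. (0, X i (snd p)))" by (auto simp: Inr)
  ultimately show ?thesis unfolding differentiable_def by auto
qed

section \<open>The Hessian identity for powers of an eikonal function\<close>

lemma has_derivative_powr_const:
  fixes f :: "'a::real_normed_vector \<Rightarrow> real"
  assumes "(f has_derivative f') (at p)" "0 < f p"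
  shows "((\<lambda>q. f q powr a) has_derivative (\<lambda>h. a * f p powr (a - 1) * f' h)) (at p)"
  using DERIV_compose_FDERIV[OF has_real_derivative_powr[OF assms(2)] assms(1), of a]
  by (simp add: mult.commute)

text \<open>Entry \<open>k\<close>, \<open>l\<close> of the Hessian applies the \<open>k\<close>-th
  field last. Row \<open>k\<close> paired with the gradient is therefore half the
  \<open>k\<close>-th derivative of the squared gradient, and no fields have to be commuted. That
  squared gradient is an explicit power of \<open>F\<close> by the eikonal hypothesis.\<close>

lemma doubled_hess_powr:
  fixes X :: "'n::finite \<Rightarrow> real^'n \<Rightarrow> real^'n"
  assumes "open W" "p \<in> W"
    and F: "\<And>q. q \<in> W \<Longrightarrow> (F has_derivative F' q) (at q)"
    and pos: "\<And>q. q \<in> W \<Longrightarrow> 0 < F q"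
    and diff: "\<And>l. (\<lambda>q. F' q (doubled_field X l q)) differentiable (at p)"
    and eikonal: "\<And>q. q \<in> W \<Longrightarrow> (\<Sum>l\<in>UNIV. (F' q (doubled_field X l q))\<^sup>2) = c"
  shows "(doubled_hess X (\<lambda>q. F q powr \<alpha>) p *v doubled_grad X (\<lambda>q. F q powr \<alpha>) p)
           \<bullet> doubled_grad X (\<lambda>q. F q powr \<alpha>) p
         = c\<^sup>2 * \<alpha> ^ 3 * (\<alpha> - 1) * F p powr (3 * \<alpha> - 4)"
proof -
  let ?u = "\<lambda>q. F q powr \<alpha>"
  define w where "w l q = \<alpha> * F q powr (\<alpha> - 1) * F' q (doubled_field X l q)" for l q
  have u_deriv: "doubled_deriv X l ?u q = w l q" if "q \<in> W" for l q
    using doubled_deriv_eq[OF has_derivative_powr_const[OF F[OF that] pos[OF that]]]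
    by (simp add: w_def)
  have "(\<lambda>q. F q powr (\<alpha> - 1)) differentiable (at p)"
    using has_derivative_powr_const[OF F pos] \<open>p \<in> W\<close> unfolding differentiable_def by blast
  then have "w l differentiable (at p)" for l
    unfolding w_def using diff by (intro differentiable_mult differentiable_const)
  then obtain w' where w': "\<And>l. (w l has_derivative w' l) (at p)"
    unfolding differentiable_def by metis
  \<comment> \<open>The formula \<open>w l\<close> for the first derivative holds only on
    \<open>W\<close>; openness lets its derivative at \<open>p\<close> be transferred.\<close>
  have "(doubled_deriv X l ?u has_derivative w' l) (at p)" for l
    by (rule has_derivative_transform_within_open[OF w' \<open>open W\<close> \<open>p \<in> W\<close>]) (simp add: u_deriv)
  then have hess: "doubled_deriv X k (doubled_deriv X l ?u) p = w' l (doubled_field X k p)" for k l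
    by (rule doubled_deriv_eq)
  have sum_w: "(\<Sum>l\<in>UNIV. (w l q)\<^sup>2) = c * \<alpha>\<^sup>2 * F q powr (2 * \<alpha> - 2)" if "q \<in> W" for q
  proof -
    have "(F q powr (\<alpha> - 1))\<^sup>2 = F q powr (2 * \<alpha> - 2)"
      by (simp add: power2_eq_square flip: powr_add)
    then have "(\<Sum>l\<in>UNIV. (w l q)\<^sup>2)
        = \<alpha>\<^sup>2 * F q powr (2 * \<alpha> - 2) * (\<Sum>l\<in>UNIV. (F' q (doubled_field X l q))\<^sup>2)"
      unfolding sum_distrib_left w_def by (simp only: power_mult_distrib)
    then show ?thesis by (simp add: eikonal[OF that])
  qed
  \<comment> \<open>The sum of squares is differentiated termwise and again through its closed form
    \<open>sum_w\<close>; uniqueness of the derivative equates the results.\<close>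
  have "((\<lambda>q. \<Sum>l\<in>UNIV. (w l q)\<^sup>2) has_derivative (\<lambda>h. \<Sum>l\<in>UNIV. 2 * w l p * w' l h)) (at p)"
    by (auto intro!: derivative_eq_intros w' simp: mult_ac)
  moreover have "((\<lambda>q. \<Sum>l\<in>UNIV. (w l q)\<^sup>2) has_derivative
      (\<lambda>h. c * \<alpha>\<^sup>2 * ((2 * \<alpha> - 2) * F p powr (2 * \<alpha> - 2 - 1) * F' p h))) (at p)"
  proof (rule has_derivative_transform_within_open[OF _ \<open>open W\<close> \<open>p \<in> W\<close>])
    show "((\<lambda>q. c * \<alpha>\<^sup>2 * F q powr (2 * \<alpha> - 2)) has_derivative
        (\<lambda>h. c * \<alpha>\<^sup>2 * ((2 * \<alpha> - 2) * F p powr (2 * \<alpha> - 2 - 1) * F' p h))) (at p)"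
      using F pos \<open>p \<in> W\<close> by (intro has_derivative_mult_right has_derivative_powr_const) auto
  qed (simp add: sum_w)
  ultimately have dsum: "(\<Sum>l\<in>UNIV. 2 * w l p * w' l h)
      = c * \<alpha>\<^sup>2 * ((2 * \<alpha> - 2) * F p powr (2 * \<alpha> - 2 - 1) * F' p h)" for h
    by (rule fun_cong[OF has_derivative_unique])
  have key: "(\<Sum>l\<in>UNIV. w' l h * w l p) = c * \<alpha>\<^sup>2 * (\<alpha> - 1) * F p powr (2 * \<alpha> - 3) * F' p h" for h
  proof -
    have "2 * (\<Sum>l\<in>UNIV. w' l h * w l p) = (\<Sum>l\<in>UNIV. 2 * w l p * w' l h)"
      by (simp add: sum_distrib_left mult_ac)
    also have "\<dots> = 2 * (c * \<alpha>\<^sup>2 * (\<alpha> - 1) * F p powr (2 * \<alpha> - 2 - 1) * F' p h)"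
      unfolding dsum by (simp add: algebra_simps)
    also have "2 * \<alpha> - 2 - 1 = 2 * \<alpha> - 3" by simp
    finally show ?thesis by simp
  qed
  have "(doubled_hess X ?u p *v doubled_grad X ?u p) \<bullet> doubled_grad X ?u p
      = (\<Sum>k\<in>UNIV. (\<Sum>l\<in>UNIV. w' l (doubled_field X k p) * w l p) * w k p)"
    using \<open>p \<in> W\<close>
    by (simp add: doubled_hess_def doubled_grad_def matrix_vector_mult_def inner_vec_def hess u_deriv)
  \<comment> \<open>Both \<open>key\<close> and \<open>w k p\<close> contain the derivative of
    \<open>F\<close> along the \<open>k\<close>-th field, so a second eikonal sum appears and
    supplies the other factor \<open>c\<close>.\<close>
  also have "\<dots> = c * \<alpha> ^ 3 * (\<alpha> - 1) * (F p powr (2 * \<alpha> - 3) * F p powr (\<alpha> - 1)) *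
      (\<Sum>k\<in>UNIV. (F' p (doubled_field X k p))\<^sup>2)"
    unfolding key unfolding w_def sum_distrib_left
    by (simp add: power2_eq_square power3_eq_cube mult_ac)
  also have "F p powr (2 * \<alpha> - 3) * F p powr (\<alpha> - 1) = F p powr (3 * \<alpha> - 4)"
    by (simp flip: powr_add)
  finally show ?thesis
    unfolding eikonal[OF \<open>p \<in> W\<close>] by (simp add: power2_eq_square mult_ac)
qed

text \<open>A matrix and its transpose have the same quadratic form, so averaging them changes
  nothing. This reduces the symmetrized identity to the plain one.\<close>

lemma quadratic_form_sym_part: "(sym_part A *v v) \<bullet> v = (A *v v) \<bullet> v"
proof -
  have "(transpose A *v v) \<bullet> v = (A *v v) \<bullet> v"
    by (metis dot_lmul_matrix inner_commute transpose_matrix_vector)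
  then show ?thesis
    by (simp add: sym_part_def scaleR_matrix_vector_assoc[symmetric] matrix_vector_mult_add_rdistrib inner_add_left)
qed

section \<open>Application to the distance function\<close>

text \<open>The sum splits over the two variables and each half is 1. Symmetry of the distance
  reduces the second variable to the first.\<close>

lemma frame_dist_doubled_eikonal:
  fixes X :: "'n::finite \<Rightarrow> real^'n \<Rightarrow> real^'n"
  assumes X: "smooth_frame X" and "fst q \<noteq> snd q"
    and F: "((\<lambda>(x, y). frame_dist X x y) has_derivative F') (at q)"
  shows "(\<Sum>l\<in>UNIV. (F' (doubled_field X l q))\<^sup>2) = 2"
proof -
  obtain x y where q: "q = (x, y)" by (cases q)
  with assms(2) have "x \<noteq> y" by simp
  have "((\<lambda>z. frame_dist X z y) has_derivative (\<lambda>h. F' (h, 0))) (at x)"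
    using has_derivative_fst_slot[OF F[unfolded q]] by simp
  then have 1: "(\<Sum>i\<in>UNIV. (F' (X i x, 0))\<^sup>2) = 1"
    by (rule frame_dist_eikonal[OF X \<open>x \<noteq> y\<close>])
  have "((\<lambda>z. frame_dist X z x) has_derivative (\<lambda>h. F' (0, h))) (at y)"
    using has_derivative_snd_slot[OF F[unfolded q]] by (simp add: frame_dist_commute[OF X, of x])
  then have 2: "(\<Sum>i\<in>UNIV. (F' (0, X i y))\<^sup>2) = 1"
    by (rule frame_dist_eikonal[OF X \<open>x \<noteq> y\<close>[symmetric]])
  have "(\<Sum>l\<in>UNIV. (F' (doubled_field X l q))\<^sup>2)
      = (\<Sum>l\<in>UNIV <+> UNIV. (F' (doubled_field X l q))\<^sup>2)"
    by (simp only: UNIV_Plus_UNIV)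
  also have "\<dots> = 2"
    by (subst sum.Plus) (simp_all add: q 1 2)
  finally show ?thesis .
qed

text \<open>\<open>Ck_on\<close> speaks only of derivatives in fixed directions. Expanding the
  moving direction \<open>V q\<close> in the standard basis turns the derivative along
  \<open>V\<close> into a finite sum of products of functions differentiable at
  \<open>p\<close>.\<close>

lemma smooth_on_derivative_along_differentiable:
  fixes f :: "'a::euclidean_space \<Rightarrow> 'b::real_normed_vector" and V :: "'a \<Rightarrow> 'a"
  assumes "smooth_on W f" "open W" "p \<in> W" and V: "V differentiable (at p)"
  shows "(\<lambda>q. frechet_derivative f (at q) (V q)) differentiable (at p)"
proof -
  have "Ck_on (Suc (Suc 0)) W f" using assms(1) unfolding smooth_on_def by blast
  then have D1: "\<And>q. q \<in> W \<Longrightarrow> f differentiable (at q)"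
    and D2: "\<And>v. (\<lambda>q. frechet_derivative f (at q) v) differentiable (at p)"
    using \<open>p \<in> W\<close> by auto
  have "(\<lambda>q. \<Sum>b\<in>Basis. (V q \<bullet> b) *\<^sub>R frechet_derivative f (at q) b) differentiable (at p)"
    using V D2
    by (intro differentiable_sum ballI differentiable_scaleR differentiable_inner differentiable_const) auto
  then obtain D where D: "((\<lambda>q. \<Sum>b\<in>Basis. (V q \<bullet> b) *\<^sub>R frechet_derivative f (at q) b) has_derivative D) (at p)"
    unfolding differentiable_def by blast
  have "((\<lambda>q. frechet_derivative f (at q) (V q)) has_derivative D) (at p)"
  proof (rule has_derivative_transform_within_open[OF D \<open>open W\<close> \<open>p \<in> W\<close>])
    fix q assume "q \<in> W"
    then have lin: "linear (frechet_derivative f (at q))"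
      using D1 linear_frechet_derivative by blast
    have "frechet_derivative f (at q) (V q) = frechet_derivative f (at q) (\<Sum>b\<in>Basis. (V q \<bullet> b) *\<^sub>R b)"
      by (simp add: euclidean_representation)
    then show "(\<Sum>b\<in>Basis. (V q \<bullet> b) *\<^sub>R frechet_derivative f (at q) b) = frechet_derivative f (at q) (V q)"
      by (simp add: linear_sum[OF lin] linear_cmul[OF lin])
  qed
  then show ?thesis unfolding differentiable_def by blast
qed

theorem lemma3p2:
  fixes X :: "'n::finite \<Rightarrow> real^'n \<Rightarrow> real^'n"
    and \<alpha> :: real
    and W :: "((real^'n) \<times> (real^'n)) set"
    and x y :: "real^'n"
  assumes "smooth_frame X"
    and "open W"
    and "W \<subseteq> {(x, y). x \<noteq> y}"
    and "smooth_on W (\<lambda>(x, y). frame_dist X x y)"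
    and "(x, y) \<in> W"
  shows "let u = (\<lambda>(x, y). frame_dist X x y powr \<alpha>);
             D = doubled_grad X u (x, y);
             H = doubled_hess X u (x, y);
             d = frame_dist X x y
         in (H *v D) \<bullet> D = 4 * \<alpha> ^ 3 * (\<alpha> - 1) * d powr (3 * \<alpha> - 4) \<and>
            (sym_part H *v D) \<bullet> D = 4 * \<alpha> ^ 3 * (\<alpha> - 1) * d powr (3 * \<alpha> - 4)"
proof -
  let ?F = "\<lambda>(x, y). frame_dist X x y"
  have "Ck_on (Suc 0) W ?F" using assms(4) unfolding smooth_on_def by blast
  then have F: "(?F has_derivative frechet_derivative ?F (at q)) (at q)" if "q \<in> W" for q
    using that frechet_derivative_works by auto
  have ne: "fst q \<noteq> snd q" if "q \<in> W" for q
    using assms(3) that by auto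
  have "(doubled_hess X (\<lambda>q. ?F q powr \<alpha>) (x, y) *v doubled_grad X (\<lambda>q. ?F q powr \<alpha>) (x, y))
           \<bullet> doubled_grad X (\<lambda>q. ?F q powr \<alpha>) (x, y)
         = 2\<^sup>2 * \<alpha> ^ 3 * (\<alpha> - 1) * ?F (x, y) powr (3 * \<alpha> - 4)"
  \<comment> \<open>Here \<open>c = 2\<close>, one unit from each variable, and its square is the
    factor 4 in the claim.\<close>
  proof (rule doubled_hess_powr[OF assms(2,5) F])
    show "0 < ?F q" if "q \<in> W" for q
      using frame_dist_pos[OF assms(1) ne[OF that]] by (simp add: case_prod_beta)
    show "(\<lambda>q. frechet_derivative ?F (at q) (doubled_field X l q)) differentiable (at (x, y))" for l
      by (rule smooth_on_derivative_along_differentiable[OF assms(4,2,5)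
            doubled_field_differentiable[OF assms(1)]])
    show "(\<Sum>l\<in>UNIV. (frechet_derivative ?F (at q) (doubled_field X l q))\<^sup>2) = 2" if "q \<in> W" for q
      by (rule frame_dist_doubled_eikonal[OF assms(1) ne[OF that] F[OF that]])
  qed
  moreover have "(\<lambda>q. ?F q powr \<alpha>) = (\<lambda>(x, y). frame_dist X x y powr \<alpha>)"
    by (simp add: case_prod_beta fun_eq_iff)
  ultimately show ?thesis
    by (simp add: Let_def quadratic_form_sym_part)
qed

end
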